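(* Let $(X,d)$ be a metric space, let $f_n:X\to X$, $n\ge0$, be maps, let $A=(a_{ij})_{N\times N}$ be a transition matrix, and let $V_i$, $1\le i\le N$, be nonempty subsets of $X$ with $d(V_i,V_j)>0$ for all $1\le i\neq j\le N$. Assume that there exist nonempty compact subsets $V_{i,n}$ of $X$ with $V_{i,n}\subset V_i$, $1\le i\le N$, $n\ge0$, such that $\{f_n\}_{n=0}^\infty$ is equi-continuous in $E:=\bigcup_{n=0}^{\infty}\bigcup_{i=1}^{N}V_{i,n}$ and $V_\alpha^{m,n}:=\bigcap_{k=0}^{m}f_n^{-k}(V_{a_k,n+k})\neq\emptyset$ for all $m,n\ge0$ and all $\alpha=(a_0,a_1,\dots)\in\Sigma_N^+(A)$. Then for every $n\ge0$ there exists a nonempty compact subset $\Lambda_n\subset\bigcup_{i=1}^N V_{i,n}$ with $f_n(\Lambda_n)\subset\Lambda_{n+1}$ such that the invariant subsystem of $x_{n+1}=f_n(x_n)$ on $\{\Lambda_n\}_{n=0}^\infty$ is topologically equi-semiconjugate to $(\Sigma_N^+(A),\sigma_A)$. Consequently, if $(X,d)$ is compact, then $h(f_{0,\infty},\Lambda_0)\ge\log\rho(A)$.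
   Context: The maps $f_n$ define the non-autonomous discrete system $x_{n+1}=f_n(x_n)$, $n\ge0$; $f_{0,\infty}:=\{f_n\}_{n=0}^\infty$. Notation: $f_i^n:=f_{i+n-1}\circ\cdots\circ f_i$ for $n\ge1$, $f_i^0$ is the identity, and $f_i^{-n}:=(f_i^n)^{-1}$ (preimage). $d(B,C):=\inf\{d(b,c):b\in B,c\in C\}$. A sequence of maps $h_n:\Lambda_n\to Y$ into a metric space $(Y,e)$ is equi-continuous in $\{\Lambda_n\}_{n=0}^\infty$ if for every $\epsilon>0$ there is $\delta>0$ such that $e(h_n(x),h_n(y))<\epsilon$ for all $n\ge0$ and all $x,y\in\Lambda_n$ with $d(x,y)<\delta$; "equi-continuous in $E$" means this with $\Lambda_n=E$ for all $n$. A transition matrix is a matrix $A=(a_{ij})_{N\times N}$, $N\ge2$, with $a_{ij}\in\{0,1\}$, $\sum_{j=1}^N a_{ij}\ge1$ for all $i$ and $\sum_{i=1}^N a_{ij}\ge1$ for all $j$. $\Sigma_N^+(A):=\{s=(s_0,s_1,\dots):1\le s_j\le N,\ a_{s_js_{j+1}}=1,\ j\ge0\}$, with metric $\hat\rho(\alpha,\beta):=\sum_{i=0}^\infty \hat d(a_i,b_i)/2^i$ for $\alpha=(a_0,a_1,\dots)$, $\beta=(b_0,b_1,\dots)$, where $\hat d(a,b)=0$ if $a=b$ and $1$ otherwise. $\sigma_A:\Sigma_N^+(A)\to\Sigma_N^+(A)$, $\sigma_A((s_0,s_1,s_2,\dots)):=(s_1,s_2,\dots)$. $\rho(A):=\lim_{n\to\infty}\|A^n\|^{1/n}$,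 where $\|B\|$ denotes the sum of all entries of $B$. For subsets $\Lambda_n\subset X$ with $f_n(\Lambda_n)\subset\Lambda_{n+1}$ for all $n\ge0$, the system restricted to $\{\Lambda_n\}$ is called the invariant subsystem on $\{\Lambda_n\}_{n=0}^\infty$. It is topologically equi-semiconjugate to $(\Sigma_N^+(A),\sigma_A)$ if there are surjective maps $h_n:\Lambda_n\to\Sigma_N^+(A)$, $n\ge0$, with $\{h_n\}$ equi-continuous in $\{\Lambda_n\}$, such that $h_{n+1}\circ f_n=\sigma_A\circ h_n$ on $\Lambda_n$ for all $n\ge0$. Topological entropy: for compact $X$ and nonempty $Y\subset X$, $h(f_{0,\infty},Y):=\sup_{\mathcal A}\limsup_{n\to\infty}\frac1n\log\mathcal N(\mathcal A_0^n|_Y)$, the supremum over open covers $\mathcal A$ of $X$, where $\mathcal A_0^n:=\{\bigcap_{j=0}^{n-1}f_0^{-j}(A_j):A_j\in\mathcal A\}$, $\mathcal B|_Y:=\{B\cap Y:B\in\mathcal B\}$, and $\mathcal N(\cdot)$ is the minimal cardinality of a subcover. *)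

theory Defs
  imports "HOL-Analysis.Analysis"
begin

text \<open>
  The ambient metric space \<open>X\<close> is the type \<open>'a\<close>. The symbols \<open>1, \<dots>, N\<close> are the elements of a
  finite type \<open>'n\<close>, so that \<open>N = CARD('n)\<close>; the entry \<open>a\<^sub>i\<^sub>j\<close> of \<open>A\<close> is \<open>A $ i $ j\<close>.
\<close>

section \<open>Non-autonomous discrete systems\<close>

primrec iter_from :: "(nat \<Rightarrow> 'a \<Rightarrow> 'a) \<Rightarrow> nat \<Rightarrow> nat \<Rightarrow> 'a \<Rightarrow> 'a" where
  "iter_from f i 0 = id"
| "iter_from f i (Suc n) = f (i + n) \<circ> iter_from f i n"

text \<open>
  The metric \<open>e\<close> of the codomain is an explicit argument because the sequence space below does
  not carry its metric through a type class.
\<close>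

definition equi_continuous_in ::
    "('b \<Rightarrow> 'b \<Rightarrow> real) \<Rightarrow> (nat \<Rightarrow> 'a::metric_space set) \<Rightarrow> (nat \<Rightarrow> 'a \<Rightarrow> 'b) \<Rightarrow> bool" where
  "equi_continuous_in e \<Lambda> h \<longleftrightarrow>
     (\<forall>\<epsilon>>0. \<exists>\<delta>>0. \<forall>n. \<forall>x\<in>\<Lambda> n. \<forall>y\<in>\<Lambda> n. dist x y < \<delta> \<longrightarrow> e (h n x) (h n y) < \<epsilon>)"

section \<open>Transition matrices and one-sided subshifts of finite type\<close>

definition transition_matrix :: "real ^ 'n ^ 'n \<Rightarrow> bool" where
  "transition_matrix A \<longleftrightarrow>
     CARD('n) \<ge> 2 \<and>
     (\<forall>i j. A $ i $ j \<in> {0, 1}) \<and>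
     (\<forall>i. (\<Sum>j\<in>UNIV. A $ i $ j) \<ge> 1) \<and>
     (\<forall>j. (\<Sum>i\<in>UNIV. A $ i $ j) \<ge> 1)"

definition shift_space :: "real ^ 'n ^ 'n \<Rightarrow> (nat \<Rightarrow> 'n) set" where
  "shift_space A = {s. \<forall>j. A $ s j $ s (Suc j) = 1}"

definition symbol_dist :: "'n \<Rightarrow> 'n \<Rightarrow> real" where
  "symbol_dist a b = (if a = b then 0 else 1)"

definition seq_dist :: "(nat \<Rightarrow> 'n) \<Rightarrow> (nat \<Rightarrow> 'n) \<Rightarrow> real" where
  "seq_dist \<alpha> \<beta> = (\<Sum>i. symbol_dist (\<alpha> i) (\<beta> i) / 2 ^ i)"

definition shift :: "(nat \<Rightarrow> 'n) \<Rightarrow> (nat \<Rightarrow> 'n)" where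
  "shift s = (\<lambda>j. s (Suc j))"

text \<open>
  On \<open>real ^ 'n ^ 'n\<close> the operations \<open>*\<close> and \<open>^\<close> act entrywise, so the power of a matrix is
  obtained by iterating the matrix product \<open>**\<close>.
\<close>

definition matrix_power :: "real ^ 'n ^ 'n \<Rightarrow> nat \<Rightarrow> real ^ 'n ^ 'n" where
  "matrix_power A n = (((**) A) ^^ n) (mat 1)"

definition entry_sum :: "real ^ 'n ^ 'n \<Rightarrow> real" where
  "entry_sum B = (\<Sum>i\<in>UNIV. \<Sum>j\<in>UNIV. B $ i $ j)"

definition growth_rate :: "real ^ 'n ^ 'n \<Rightarrow> real" where
  "growth_rate A = lim (\<lambda>n. root n (entry_sum (matrix_power A n)))"

section \<open>Equi-semiconjugacy of an invariant subsystem to a subshift\<close>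

definition invariant_family :: "(nat \<Rightarrow> 'a \<Rightarrow> 'a) \<Rightarrow> (nat \<Rightarrow> 'a set) \<Rightarrow> bool" where
  "invariant_family f \<Lambda> \<longleftrightarrow> (\<forall>n. f n ` \<Lambda> n \<subseteq> \<Lambda> (Suc n))"

definition equi_semiconjugate_to_shift ::
    "(nat \<Rightarrow> 'a::metric_space \<Rightarrow> 'a) \<Rightarrow> (nat \<Rightarrow> 'a set) \<Rightarrow> real ^ 'n ^ 'n \<Rightarrow> bool" where
  "equi_semiconjugate_to_shift f \<Lambda> A \<longleftrightarrow>
     (\<exists>h :: nat \<Rightarrow> 'a \<Rightarrow> (nat \<Rightarrow> 'n).
        (\<forall>n. h n ` \<Lambda> n = shift_space A) \<and>
        equi_continuous_in seq_dist \<Lambda> h \<and>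
        (\<forall>n. \<forall>x\<in>\<Lambda> n. h (Suc n) (f n x) = shift (h n x)))"

section \<open>Topological entropy\<close>

definition open_cover :: "'a::topological_space set set \<Rightarrow> bool" where
  "open_cover \<A> \<longleftrightarrow> (\<forall>U\<in>\<A>. open U) \<and> \<Union>\<A> = UNIV"

definition joined_cover :: "(nat \<Rightarrow> 'a \<Rightarrow> 'a) \<Rightarrow> 'a set set \<Rightarrow> nat \<Rightarrow> 'a set set" where
  "joined_cover f \<A> n = {\<Inter>j<n. iter_from f 0 j -` C j | C. \<forall>j<n. C j \<in> \<A>}"

definition restrict_cover :: "'a set set \<Rightarrow> 'a set \<Rightarrow> 'a set set" where
  "restrict_cover \<B> Y = (\<lambda>B. B \<inter> Y) ` \<B>"

text \<open>
  The minimum is taken over the finite subcovers of \<open>Y\<close>. In a compact space the covers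
  \<open>restrict_cover (joined_cover f \<A> n) Y\<close> with \<open>open_cover \<A>\<close> have one, since \<open>\<A>\<close> has a finite
  subcover.
\<close>

definition min_subcover_card :: "'a set \<Rightarrow> 'a set set \<Rightarrow> nat" where
  "min_subcover_card Y \<B> = Inf {card \<C> | \<C>. \<C> \<subseteq> \<B> \<and> finite \<C> \<and> Y \<subseteq> \<Union>\<C>}"

text \<open>Only meaningful when \<open>'a\<close> is compact and \<open>Y\<close> is nonempty.\<close>

definition top_entropy ::
    "(nat \<Rightarrow> 'a::topological_space \<Rightarrow> 'a) \<Rightarrow> 'a set \<Rightarrow> ereal" where
  "top_entropy f Y =
     (SUP \<A>\<in>{\<A>. open_cover \<A>}.
        limsup (\<lambda>n. ereal
          (1 / real n * ln (real (min_subcover_card Y (restrict_cover (joined_cover f \<A> n) Y))))))"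

end

theory Submission
  imports Defs
begin

text \<open>
  Let \<open>\<Lambda>\<^sub>n\<close> be the set of points whose orbit from time \<open>n\<close> on follows some \<open>\<alpha> \<in> \<Sigma>(A)\<close>, that is,
  \<open>f\<^sub>n\<^sup>k x \<in> V\<^bsub>\<alpha>(k), n+k\<^esub>\<close> for all \<open>k\<close>. The separation of the \<open>V\<^sub>i\<close> makes \<open>\<alpha>\<close> unique, which defines
  \<open>h\<^sub>n\<close>; by compactness every \<open>\<alpha>\<close> is followed by some point, and equi-continuity of finitely many
  iterates forces nearby points to share a long initial word. For the entropy, a cover of small
  mesh has the property that each element of its \<open>n\<close>-th join meets \<open>\<Lambda>\<^sub>0\<close> in points with one and the
  same word of length \<open>n\<close>, so a subcover is at least as large as the number of such words,
  which is the entry sum of \<open>A\<^sup>n\<^sup>-\<^sup>1\<close>. Entry sums are submultiplicative, so by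
  Fekete's lemma \<open>\<rho>(A)\<close> exists as a limit.
\<close>

section \<open>Growth rate of a transition matrix\<close>

lemma subadditive_mult_le:
  fixes a :: "nat \<Rightarrow> real"
  assumes sub: "\<And>m n. a (m + n) \<le> a m + a n"
  shows "a (q * m + r) \<le> real q * a m + a r"
proof (induction q)
  case (Suc q)
  have "a (Suc q * m + r) \<le> a m + a (q * m + r)"
    using sub[of m "q * m + r"] by (simp add: algebra_simps)
  with Suc show ?case by (simp add: algebra_simps)
qed simp

text \<open>Fekete's lemma by division with remainder: fix \<open>m\<close> nearly attaining the
  infimum and write \<open>n = q * m + r\<close> with \<open>r < m\<close>. Then
  \<open>a n / n\<close> exceeds \<open>a m / m\<close> by at most a bounded amount divided by
  \<open>n\<close>. Nonnegativity keeps the infimum bounded below.\<close>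

lemma fekete_nonneg:
  fixes a :: "nat \<Rightarrow> real"
  assumes sub: "\<And>m n. a (m + n) \<le> a m + a n" and nonneg: "\<And>n. 0 \<le> a n"
  shows "(\<lambda>n. a n / real n) \<longlonglongrightarrow> (INF n\<in>{1..}. a n / real n)"
proof (rule LIMSEQ_I)
  let ?L = "INF n\<in>{1..}. a n / real n"
  fix \<epsilon> :: real assume "\<epsilon> > 0"
  have bdd: "bdd_below ((\<lambda>n. a n / real n) ` {1..})"
    by (rule bdd_belowI2[where m = 0]) (simp add: nonneg)
  obtain m where m: "m \<ge> 1" "a m / real m < ?L + \<epsilon> / 2"
    using cInf_lessD[of "(\<lambda>n. a n / real n) ` {1..}" "?L + \<epsilon> / 2"] \<open>\<epsilon> > 0\<close> by auto
  \<comment> \<open>One bound for all remainders modulo \<open>m\<close>: a sum of nonnegative terms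
    dominates each of them.\<close>
  define C where "C = (\<Sum>r<m. a r)"
  have C: "a r \<le> C" if "r < m" for r
    unfolding C_def using that nonneg by (intro member_le_sum) auto
  obtain n0 :: nat where n0: "2 * C / \<epsilon> < real n0" using reals_Archimedean2 by blast
  have "norm (a n / real n - ?L) < \<epsilon>" if "n \<ge> max 1 n0" for n
  proof -
    have n: "n \<ge> 1" "2 * C / \<epsilon> < real n" using that n0 by auto
    have "a n \<le> real (n div m) * a m + a (n mod m)"
      using subadditive_mult_le[of a "n div m" m "n mod m", OF sub] by simp
    also have "\<dots> \<le> (real n / real m) * a m + C"
      using m C[of "n mod m"] nonneg[of m]
      by (intro add_mono mult_right_mono of_nat_div_le_of_nat) auto
    finally have "a n / real n \<le> ((real n / real m) * a m + C) / real n"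
      using n by (intro divide_right_mono) auto
    also have "\<dots> = a m / real m + C / real n"
      using n m by (simp add: field_simps)
    also have "C / real n < \<epsilon> / 2"
      using n \<open>\<epsilon> > 0\<close> by (simp add: field_simps)
    finally have "a n / real n < ?L + \<epsilon>" using m by simp
    moreover have "?L \<le> a n / real n"
      using n by (intro cINF_lower bdd) auto
    ultimately show ?thesis by simp
  qed
  then show "\<exists>no. \<forall>n\<ge>no. norm (a n / real n - ?L) < \<epsilon>" by blast
qed

section \<open>Powers and entry sums of nonnegative matrices\<close>

lemma matrix_power_0: "matrix_power A 0 = mat 1"
  and matrix_power_Suc: "matrix_power A (Suc n) = A ** matrix_power A n"
  by (simp_all add: matrix_power_def)

lemma matrix_power_add: "matrix_power A (m + n) = matrix_power A m ** matrix_power A n"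
  by (induction m) (simp_all add: matrix_power_0 matrix_power_Suc matrix_mul_assoc)

lemma matrix_power_nonneg:
  assumes "\<And>i j. 0 \<le> A $ i $ j"
  shows "0 \<le> matrix_power A n $ i $ j"
proof (induction n arbitrary: i j)
  case 0
  then show ?case by (simp add: matrix_power_0 mat_def)
next
  case (Suc n)
  then show ?case
    by (simp add: matrix_power_Suc matrix_matrix_mult_def sum_nonneg assms)
qed

text \<open>Expanded, the right side contains every product of an entry of \<open>B\<close> with an
  entry of \<open>C\<close>, the left side only those with matching inner index. Equivalently, each
  row sum of \<open>C\<close> is at most \<open>entry_sum C\<close>.\<close>

lemma entry_sum_mult_le:
  assumes B: "\<And>i j. 0 \<le> B $ i $ j" and C: "\<And>i j. 0 \<le> C $ i $ j"
  shows "entry_sum (B ** C) \<le> entry_sum B * entry_sum C"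
proof -
  have "entry_sum (B ** C) = (\<Sum>i\<in>UNIV. \<Sum>j\<in>UNIV. \<Sum>k\<in>UNIV. B $ i $ k * C $ k $ j)"
    by (simp add: entry_sum_def matrix_matrix_mult_def)
  also have "\<dots> = (\<Sum>i\<in>UNIV. \<Sum>k\<in>UNIV. B $ i $ k * (\<Sum>j\<in>UNIV. C $ k $ j))"
    by (subst sum.swap) (simp add: sum_distrib_left)
  also have "\<dots> \<le> (\<Sum>i\<in>UNIV. \<Sum>k\<in>UNIV. B $ i $ k * entry_sum C)"
    unfolding entry_sum_def
    by (intro sum_mono mult_left_mono B member_le_sum[where f = "\<lambda>k. \<Sum>j\<in>UNIV. C $ k $ j"])
       (auto intro: sum_nonneg C)
  also have "\<dots> = entry_sum B * entry_sum C"
    by (simp add: entry_sum_def sum_distrib_right)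
  finally show ?thesis .
qed

section \<open>Admissible words\<close>

text \<open>Words are prefixes of infinite admissible sequences, so surjectivity of a semiconjugacy
  realizes each of them by a point.\<close>

definition words :: "real ^ 'n ^ 'n \<Rightarrow> nat \<Rightarrow> 'n list set" where
  "words A n = (\<lambda>s. map s [0..<n]) ` shift_space A"

definition words_from :: "real ^ 'n ^ 'n \<Rightarrow> nat \<Rightarrow> 'n \<Rightarrow> 'n list set" where
  "words_from A n i = (\<lambda>s. map s [0..<n]) ` {s \<in> shift_space A. s 0 = i}"

lemma finite_words_from: "finite (words_from A n i)"
  by (rule finite_subset[OF _ finite_lists_length_eq[of UNIV n]]) (auto simp: words_from_def)

lemma transition_matrix_ex_successor:
  assumes "transition_matrix A"
  shows "\<exists>j. A $ i $ j = 1"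
proof (rule ccontr)
  assume "\<nexists>j. A $ i $ j = 1"
  then have "A $ i $ j = 0" for j using assms unfolding transition_matrix_def by auto
  then have "(\<Sum>j\<in>UNIV. A $ i $ j) = 0" by simp
  then show False using assms unfolding transition_matrix_def by (metis not_one_le_zero)
qed

text \<open>No row of \<open>A\<close> vanishes, so a choice of successors exists and its iteration
  never gets stuck.\<close>

lemma shift_space_starting_at:
  assumes "transition_matrix A"
  shows "\<exists>s\<in>shift_space A. s 0 = i"
proof -
  obtain g where g: "\<And>i. A $ i $ g i = 1"
    using transition_matrix_ex_successor[OF assms] by metis
  show ?thesis
    by (rule bexI[of _ "\<lambda>k. (g ^^ k) i"]) (auto simp: shift_space_def g)
qed

lemma shift_in_shift_space: "s \<in> shift_space A \<Longrightarrow> shift s \<in> shift_space A"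
  by (simp add: shift_space_def shift_def)

lemma case_nat_in_shift_space:
  "\<lbrakk>s \<in> shift_space A; A $ i $ s 0 = 1\<rbrakk> \<Longrightarrow> case_nat i s \<in> shift_space A"
  by (auto simp: shift_space_def split: nat.split)

lemma map_upt_Suc_shift: "map s [0..<Suc n] = s 0 # map (shift s) [0..<n]"
  by (simp add: map_upt_Suc shift_def del: upt_Suc)

text \<open>\<open>shift\<close> removes the first symbol and \<open>case_nat\<close> puts it back.
  The tails are kept nonempty, so that tails for different \<open>k\<close> begin differently and
  the union is disjoint, as the count below requires.\<close>

lemma words_from_Suc:
  "words_from A (Suc (Suc n)) i = (\<Union>k\<in>{k. A $ i $ k = 1}. (#) i ` words_from A (Suc n) k)"
proof (intro equalityI subsetI)
  fix w assume "w \<in> words_from A (Suc (Suc n)) i"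
  then obtain s where s: "s \<in> shift_space A" "s 0 = i" "w = map s [0..<Suc (Suc n)]"
    unfolding words_from_def by blast
  have "A $ i $ shift s 0 = 1" using s by (auto simp: shift_def shift_space_def)
  moreover have "w = i # map (shift s) [0..<Suc n]"
    using s map_upt_Suc_shift[of s "Suc n"] by simp
  ultimately show "w \<in> (\<Union>k\<in>{k. A $ i $ k = 1}. (#) i ` words_from A (Suc n) k)"
    using shift_in_shift_space[OF s(1)] unfolding words_from_def by blast
next
  fix w assume "w \<in> (\<Union>k\<in>{k. A $ i $ k = 1}. (#) i ` words_from A (Suc n) k)"
  then obtain s where s: "s \<in> shift_space A" "A $ i $ s 0 = 1" "w = i # map s [0..<Suc n]"
    unfolding words_from_def by blast
  have "w = map (case_nat i s) [0..<Suc (Suc n)]"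
    using s(3) map_upt_Suc_shift[of "case_nat i s" "Suc n"] by (simp add: shift_def)
  then show "w \<in> words_from A (Suc (Suc n)) i"
    using case_nat_in_shift_space[OF s(1,2)] unfolding words_from_def by force
qed

lemma hd_words_from: "w \<in> words_from A (Suc n) i \<Longrightarrow> hd w = i"
  by (auto simp: words_from_def map_upt_Suc_shift simp del: upt_Suc)

text \<open>A word of \<open>n + 1\<close> symbols has \<open>n\<close> transitions, hence the
  exponent \<open>n\<close>. The induction splits words by their second symbol.\<close>

lemma card_words_from:
  assumes A: "transition_matrix A"
  shows "real (card (words_from A (Suc n) i)) = (\<Sum>j\<in>UNIV. matrix_power A n $ i $ j)"
proof (induction n arbitrary: i)
  case 0
  have "words_from A (Suc 0) i = {[i]}"
    using shift_space_starting_at[OF A, of i] by (auto simp: words_from_def)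
  then show ?case by (simp add: matrix_power_0 mat_def)
next
  case (Suc n)
  have "card (words_from A (Suc (Suc n)) i)
      = (\<Sum>k\<in>{k. A $ i $ k = 1}. card ((#) i ` words_from A (Suc n) k))"
    unfolding words_from_Suc
    by (intro card_UN_disjoint) (auto simp: finite_words_from dest: hd_words_from)
  also have "\<dots> = (\<Sum>k\<in>{k. A $ i $ k = 1}. card (words_from A (Suc n) k))"
    by (simp add: card_image)
  finally have "real (card (words_from A (Suc (Suc n)) i))
      = (\<Sum>k\<in>{k. A $ i $ k = 1}. \<Sum>j\<in>UNIV. matrix_power A n $ k $ j)"
    by (simp add: Suc)
  \<comment> \<open>Entries are 0 or 1, so weighting by \<open>A $ i $ k\<close> selects exactly the
    successors of \<open>i\<close>.\<close>
  also have "\<dots> = (\<Sum>k\<in>UNIV. A $ i $ k * (\<Sum>j\<in>UNIV. matrix_power A n $ k $ j))"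
    using A unfolding transition_matrix_def by (intro sum.mono_neutral_cong_left) auto
  also have "\<dots> = (\<Sum>j\<in>UNIV. matrix_power A (Suc n) $ i $ j)"
    unfolding matrix_power_Suc matrix_matrix_mult_def
    by (simp add: sum_distrib_left) (rule sum.swap)
  finally show ?case .
qed

lemma card_words:
  assumes "transition_matrix A"
  shows "real (card (words A (Suc n))) = entry_sum (matrix_power A n)"
proof -
  have "words A (Suc n) = (\<Union>i. words_from A (Suc n) i)"
    by (auto simp: words_def words_from_def)
  moreover have "card (\<Union>i. words_from A (Suc n) i) = (\<Sum>i\<in>UNIV. card (words_from A (Suc n) i))"
    by (intro card_UN_disjoint) (auto simp: finite_words_from dest: hd_words_from)
  ultimately show ?thesis
    by (simp add: entry_sum_def card_words_from[OF assms])
qed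

lemma entry_sum_matrix_power_ge_1:
  assumes "transition_matrix A"
  shows "1 \<le> entry_sum (matrix_power A n)"
proof -
  have "words A (Suc n) \<noteq> {}"
    using shift_space_starting_at[OF assms] by (auto simp: words_def)
  moreover have "finite (words A (Suc n))"
    by (rule finite_subset[OF _ finite_lists_length_eq[of UNIV "Suc n"]]) (auto simp: words_def)
  ultimately have "card (words A (Suc n)) \<noteq> 0" by simp
  then show ?thesis using card_words[OF assms, of n] by linarith
qed

lemma ln_entry_sum_matrix_power_add_le:
  assumes A: "transition_matrix A"
  shows "ln (entry_sum (matrix_power A (m + n)))
    \<le> ln (entry_sum (matrix_power A m)) + ln (entry_sum (matrix_power A n))"
proof -
  note ge = entry_sum_matrix_power_ge_1[OF A]
  have pos: "0 < entry_sum (matrix_power A k)" for k using ge[of k] by linarith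
  have "0 \<le> A $ i $ j" for i j
    using A unfolding transition_matrix_def by (metis insert_iff order_refl singletonD zero_le_one)
  then have "entry_sum (matrix_power A (m + n))
      \<le> entry_sum (matrix_power A m) * entry_sum (matrix_power A n)"
    unfolding matrix_power_add by (intro entry_sum_mult_le matrix_power_nonneg)
  then have "ln (entry_sum (matrix_power A (m + n)))
      \<le> ln (entry_sum (matrix_power A m) * entry_sum (matrix_power A n))"
    using pos by (simp add: ln_mono)
  also have "\<dots> = ln (entry_sum (matrix_power A m)) + ln (entry_sum (matrix_power A n))"
    using pos by (intro ln_mult_pos)
  finally show ?thesis .
qed

text \<open>The \<open>n\<close>-th roots are exponentials of the quotients treated by
  \<open>fekete_nonneg\<close>, so the \<open>lim\<close> in \<open>growth_rate\<close> is a genuine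
  limit and its logarithm is the Fekete infimum.\<close>

lemma ln_entry_sum_tendsto_growth_rate:
  assumes A: "transition_matrix A"
  shows "(\<lambda>n. ln (entry_sum (matrix_power A n)) / real n) \<longlonglongrightarrow> ln (growth_rate A)"
proof -
  define a where "a n = ln (entry_sum (matrix_power A n))" for n
  note ge = entry_sum_matrix_power_ge_1[OF A]
  have lim: "(\<lambda>n. a n / real n) \<longlonglongrightarrow> (INF n\<in>{1..}. a n / real n)"
    using ln_entry_sum_matrix_power_add_le[OF A] ge
    by (intro fekete_nonneg) (simp_all add: a_def)
  \<comment> \<open>At \<open>n = 0\<close> the two sides are 1 and 0, by the conventions for
    division by 0 and \<open>root 0\<close>.\<close>
  have "exp (a n / real n) = root n (entry_sum (matrix_power A n))" if "n > 0" for n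
  proof -
    have "0 < entry_sum (matrix_power A n)" using ge[of n] by linarith
    then show ?thesis
      using that by (simp add: a_def root_powr_inverse powr_def)
  qed
  then have "(\<lambda>n. root n (entry_sum (matrix_power A n))) \<longlonglongrightarrow> exp (INF n\<in>{1..}. a n / real n)"
    using tendsto_exp[OF lim]
    by (rule_tac Lim_transform_eventually) (auto intro: eventually_mono[OF eventually_gt_at_top[of 0]])
  then have "growth_rate A = exp (INF n\<in>{1..}. a n / real n)"
    unfolding growth_rate_def by (rule limI)
  then show ?thesis using lim by (simp add: a_def)
qed

section \<open>Entropy of systems semiconjugate to a subshift\<close>

lemma iter_from_Suc_left: "iter_from f n (Suc k) x = iter_from f (Suc n) k (f n x)"
  by (induction k) simp_all

lemma iter_from_in_invariant_family:
  assumes "invariant_family f \<Lambda>" "x \<in> \<Lambda> n"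
  shows "iter_from f n k x \<in> \<Lambda> (n + k)"
proof (induction k)
  case (Suc k)
  then have "f (n + k) (iter_from f n k x) \<in> \<Lambda> (Suc (n + k))"
    using assms(1) unfolding invariant_family_def by blast
  then show ?case by simp
qed (use assms in simp)

text \<open>Symbol \<open>k\<close> of a code is read off as symbol 0 at time \<open>n + k\<close>,
  so closeness of orbits at that time controls symbol \<open>k\<close>.\<close>

lemma semiconjugacy_nth:
  assumes "invariant_family f \<Lambda>"
    and conj: "\<And>n x. x \<in> \<Lambda> n \<Longrightarrow> h (Suc n) (f n x) = shift (h n x)"
    and "x \<in> \<Lambda> n"
  shows "h (n + k) (iter_from f n k x) 0 = h n x k"
proof -
  \<comment> \<open>All coordinates \<open>i\<close> are needed, since each \<open>shift\<close> in
    the induction raises the coordinate.\<close>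
  have "h (n + k) (iter_from f n k x) i = h n x (i + k)" for i
  proof (induction k arbitrary: i)
    case (Suc k)
    have "iter_from f n k x \<in> \<Lambda> (n + k)"
      using assms(1,3) by (rule iter_from_in_invariant_family)
    then show ?case using Suc conj by (simp add: shift_def)
  qed simp
  then show ?thesis by simp
qed

section \<open>The metric on symbol sequences\<close>

lemma summable_seq_dist: "summable (\<lambda>i. symbol_dist (\<alpha> i) (\<beta> i) / 2 ^ i)"
proof (rule summable_comparison_test')
  show "summable (\<lambda>i. (1 / 2 :: real) ^ i)" by (simp add: summable_geometric)
  show "norm (symbol_dist (\<alpha> i) (\<beta> i) / 2 ^ i) \<le> (1 / 2) ^ i" if "i \<ge> 0" for i
    by (simp add: symbol_dist_def power_divide)
qed

lemma seq_dist_less_1D: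
  assumes "seq_dist \<alpha> \<beta> < 1"
  shows "\<alpha> 0 = \<beta> 0"
proof (rule ccontr)
  assume ne: "\<alpha> 0 \<noteq> \<beta> 0"
  have "(\<Sum>i\<in>{0}. symbol_dist (\<alpha> i) (\<beta> i) / 2 ^ i) \<le> seq_dist \<alpha> \<beta>"
    unfolding seq_dist_def
    by (intro sum_le_suminf summable_seq_dist) (auto simp: symbol_dist_def)
  then show False using assms ne by (simp add: symbol_dist_def)
qed

text \<open>Only the geometric tail from index \<open>m + 1\<close> on survives, and it sums to
  \<open>(1 / 2) ^ m\<close>.\<close>

lemma seq_dist_le_if_agree:
  assumes agree: "\<And>i. i \<le> m \<Longrightarrow> \<alpha> i = \<beta> i"
  shows "seq_dist \<alpha> \<beta> \<le> (1 / 2) ^ m"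
proof -
  define c where "c i = symbol_dist (\<alpha> i) (\<beta> i) / 2 ^ i" for i
  have sc: "summable c" unfolding c_def by (rule summable_seq_dist)
  have "seq_dist \<alpha> \<beta> = (\<Sum>i. c (i + Suc m)) + (\<Sum>i<Suc m. c i)"
    unfolding seq_dist_def c_def[symmetric] using sc by (rule suminf_split_initial_segment)
  also have "(\<Sum>i<Suc m. c i) = 0"
    using agree by (intro sum.neutral) (auto simp: c_def symbol_dist_def)
  also have "(\<Sum>i. c (i + Suc m)) \<le> (\<Sum>i. (1 / 2) ^ Suc m * (1 / 2) ^ i)"
  proof (rule suminf_le)
    show "c (i + Suc m) \<le> (1 / 2) ^ Suc m * (1 / 2) ^ i" for i
      by (simp add: c_def symbol_dist_def power_divide power_add mult.commute mult.left_commute)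
    show "summable (\<lambda>i. c (i + Suc m))" using sc by (rule summable_ignore_initial_segment)
    show "summable (\<lambda>i. (1 / 2 :: real) ^ Suc m * (1 / 2) ^ i)"
      by (intro summable_mult summable_geometric) simp
  qed
  also have "\<dots> = (1 / 2) ^ m"
    by (subst suminf_mult) (auto simp: suminf_geometric summable_geometric)
  finally show ?thesis by simp
qed

section \<open>Fine covers and their joins\<close>

lemma open_cover_finite_small:
  assumes "compact (UNIV :: 'a::metric_space set)" "\<delta> > 0"
  obtains \<A> :: "'a::metric_space set set" where "open_cover \<A>" "finite \<A>"
    "\<And>U x y. \<lbrakk>U \<in> \<A>; x \<in> U; y \<in> U\<rbrakk> \<Longrightarrow> dist x y < \<delta>"
proof -
  have "UNIV \<subseteq> (\<Union>x::'a. ball x (\<delta> / 2))"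
    using \<open>\<delta> > 0\<close> by (auto intro: centre_in_ball[THEN iffD2])
  then obtain T :: "'a set" where T: "finite T" "UNIV \<subseteq> (\<Union>x\<in>T. ball x (\<delta> / 2))"
    using assms(1) by (elim compactE_image) auto
  show ?thesis
  proof
    show "open_cover ((\<lambda>x. ball x (\<delta> / 2)) ` T)" "finite ((\<lambda>x. ball x (\<delta> / 2)) ` T)"
      using T by (auto simp: open_cover_def)
    show "dist x y < \<delta>" if "U \<in> (\<lambda>x. ball x (\<delta> / 2)) ` T" "x \<in> U" "y \<in> U" for U x y
      using that by (auto intro: dist_triangle_half_r)
  qed
qed

lemma finite_joined_cover:
  assumes "finite \<A>"
  shows "finite (joined_cover f \<A> n)"
proof -
  have "joined_cover f \<A> n
      \<subseteq> (\<lambda>C. \<Inter>j<n. iter_from f 0 j -` C j) ` (Pi\<^sub>E {..<n} (\<lambda>_. \<A>))"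
  proof
    fix B assume "B \<in> joined_cover f \<A> n"
    then obtain C where C: "B = (\<Inter>j<n. iter_from f 0 j -` C j)" "\<forall>j<n. C j \<in> \<A>"
      unfolding joined_cover_def by blast
    then show "B \<in> (\<lambda>C. \<Inter>j<n. iter_from f 0 j -` C j) ` (Pi\<^sub>E {..<n} (\<lambda>_. \<A>))"
      \<comment> \<open>Values of \<open>C\<close> from \<open>n\<close> on do not affect the
        intersection; restricting them away leaves a finite function space.\<close>
      by (intro image_eqI[of _ _ "restrict C {..<n}"]) auto
  qed
  then show ?thesis by (rule finite_subset) (intro finite_imageI finite_PiE, auto simp: assms)
qed

lemma Union_joined_cover:
  assumes "open_cover \<A>"
  shows "\<Union>(joined_cover f \<A> n) = UNIV"
proof -
  have "x \<in> \<Union>(joined_cover f \<A> n)" for x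
  proof -
    have "\<forall>j. \<exists>U\<in>\<A>. iter_from f 0 j x \<in> U"
      using assms unfolding open_cover_def by (metis UNIV_I UnionE)
    then obtain C where "\<And>j. C j \<in> \<A>" "\<And>j. iter_from f 0 j x \<in> C j" by metis
    then have "(\<Inter>j<n. iter_from f 0 j -` C j) \<in> joined_cover f \<A> n"
        "x \<in> (\<Inter>j<n. iter_from f 0 j -` C j)"
      unfolding joined_cover_def by auto
    then show ?thesis by (rule UnionI)
  qed
  then show ?thesis by (intro equalityI subset_UNIV subsetI)
qed

text \<open>The cover \<open>\<B>\<close> is itself a finite subcover, so the infimum runs over a
  nonempty set, as a lower bound for it requires.\<close>

lemma min_subcover_card_ge:
  assumes "finite \<B>" "Y \<subseteq> \<Union>\<B>"
    and "\<And>\<C>. \<lbrakk>\<C> \<subseteq> \<B>; Y \<subseteq> \<Union>\<C>\<rbrakk> \<Longrightarrow> k \<le> card \<C>"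
  shows "k \<le> min_subcover_card Y \<B>"
  unfolding min_subcover_card_def using assms by (intro cInf_greatest) auto

text \<open>Equi-continuity gives a mesh \<delta> valid at all times, so a single cover of the space
  separates words of every length.\<close>

lemma top_entropy_ge_growth_rate:
  fixes f :: "nat \<Rightarrow> 'a::metric_space \<Rightarrow> 'a" and A :: "real ^ 'n ^ 'n"
  assumes cpt: "compact (UNIV :: 'a set)" and A: "transition_matrix A"
    and inv: "invariant_family f \<Lambda>" and semi: "equi_semiconjugate_to_shift f \<Lambda> A"
  shows "top_entropy f (\<Lambda> 0) \<ge> ereal (ln (growth_rate A))"
proof -
  obtain h :: "nat \<Rightarrow> 'a \<Rightarrow> nat \<Rightarrow> 'n" where h: "h 0 ` \<Lambda> 0 = shift_space A"
      "equi_continuous_in seq_dist \<Lambda> h"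
      "\<And>n x. x \<in> \<Lambda> n \<Longrightarrow> h (Suc n) (f n x) = shift (h n x)"
    using semi unfolding equi_semiconjugate_to_shift_def by metis
  obtain \<delta> where "\<delta> > 0" and \<delta>:
      "\<And>n x y. \<lbrakk>x \<in> \<Lambda> n; y \<in> \<Lambda> n; dist x y < \<delta>\<rbrakk> \<Longrightarrow> seq_dist (h n x) (h n y) < 1"
    using h(2) zero_less_one unfolding equi_continuous_in_def by metis
  obtain \<A> :: "'a set set" where \<A>: "open_cover \<A>" "finite \<A>"
      "\<And>U x y. \<lbrakk>U \<in> \<A>; x \<in> U; y \<in> U\<rbrakk> \<Longrightarrow> dist x y < \<delta>"
    using open_cover_finite_small[OF cpt \<open>\<delta> > 0\<close>] by metis
  define \<B> where "\<B> n = restrict_cover (joined_cover f \<A> n) (\<Lambda> 0)" for n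
  \<comment> \<open>At each time \<open>j < n\<close> both orbits lie in one element of
    \<open>\<A>\<close>, hence are \<delta>-close. Their codes at time \<open>j\<close> then share
    symbol 0, which is symbol \<open>j\<close> of the codes at time 0.\<close>
  have same_word: "map (h 0 x) [0..<n] = map (h 0 y) [0..<n]"
    if B: "B \<in> \<B> n" "x \<in> B" "y \<in> B" for n B x y
  proof -
    obtain C where C: "\<And>j. j < n \<Longrightarrow> C j \<in> \<A>"
        "B = (\<Inter>j<n. iter_from f 0 j -` C j) \<inter> \<Lambda> 0"
      using B(1) unfolding \<B>_def restrict_cover_def joined_cover_def by blast
    have "h 0 x j = h 0 y j" if j: "j < n" for j
    proof -
      have \<Lambda>: "x \<in> \<Lambda> 0" "y \<in> \<Lambda> 0" using B C by auto
      have "iter_from f 0 j x \<in> C j" "iter_from f 0 j y \<in> C j" using B C(2) j by auto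
      then have "dist (iter_from f 0 j x) (iter_from f 0 j y) < \<delta>"
        using \<A>(3)[OF C(1)[OF j]] by blast
      then have "h j (iter_from f 0 j x) 0 = h j (iter_from f 0 j y) 0"
        using iter_from_in_invariant_family[OF inv \<Lambda>(1), of j]
          iter_from_in_invariant_family[OF inv \<Lambda>(2), of j]
        by (intro seq_dist_less_1D \<delta>) auto
      moreover have "h j (iter_from f 0 j z) 0 = h 0 z j" if "z \<in> \<Lambda> 0" for z
        using semiconjugacy_nth[of f \<Lambda> h z 0 j] inv h(3) that by simp
      ultimately show ?thesis using \<Lambda> by simp
    qed
    then show ?thesis by simp
  qed
  have card_ge: "card (words A n) \<le> min_subcover_card (\<Lambda> 0) (\<B> n)" for n
  proof (rule min_subcover_card_ge)
    show fin: "finite (\<B> n)"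
      using finite_joined_cover[OF \<A>(2)] by (simp add: \<B>_def restrict_cover_def)
    show "\<Lambda> 0 \<subseteq> \<Union>(\<B> n)"
      using Union_joined_cover[OF \<A>(1), of f n] unfolding \<B>_def restrict_cover_def by blast
    fix \<C> assume \<C>: "\<C> \<subseteq> \<B> n" "\<Lambda> 0 \<subseteq> \<Union>\<C>"
    \<comment> \<open>Any point of a cover element shows its unique word, so choosing one point per
      element reaches all words.\<close>
    have "words A n \<subseteq> (\<lambda>B. map (h 0 (SOME x. x \<in> B)) [0..<n]) ` \<C>"
    proof
      fix w assume "w \<in> words A n"
      then obtain x where x: "x \<in> \<Lambda> 0" "w = map (h 0 x) [0..<n]"
        unfolding words_def h(1)[symmetric] by blast
      then obtain B where B: "B \<in> \<C>" "x \<in> B" using \<C> by blast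
      have "w = map (h 0 (SOME x. x \<in> B)) [0..<n]"
        unfolding x(2) using B \<C>(1) by (intro same_word[of B]) (auto intro: someI)
      with B show "w \<in> (\<lambda>B. map (h 0 (SOME x. x \<in> B)) [0..<n]) ` \<C>" by blast
    qed
    then show "card (words A n) \<le> card \<C>"
      using finite_subset[OF \<C>(1) fin] by (rule surj_card_le[rotated])
  qed
  define s where "s n = entry_sum (matrix_power A n)" for n
  have s_ge: "1 \<le> s n" for n unfolding s_def by (rule entry_sum_matrix_power_ge_1[OF A])
  \<comment> \<open>Words of length \<open>n\<close> number \<open>s (n - 1)\<close>.
    Submultiplicativity replaces this by \<open>s n\<close> at the cost of
    \<open>ln (s 1) / n\<close>, which tends to 0.\<close>
  have lower: "ln (s n) / real n - ln (s 1) / real n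
      \<le> 1 / real n * ln (real (min_subcover_card (\<Lambda> 0) (\<B> n)))" if n: "n > 0" for n
  proof -
    obtain m where m: "n = Suc m" using n by (cases n) auto
    have "ln (s n) \<le> ln (s 1) + ln (s m)"
      using ln_entry_sum_matrix_power_add_le[OF A, of 1 m] by (simp add: s_def m)
    moreover have "s m \<le> real (min_subcover_card (\<Lambda> 0) (\<B> n))"
      using card_ge[of n] card_words[OF A, of m] by (simp add: s_def m)
    then have "ln (s m) \<le> ln (real (min_subcover_card (\<Lambda> 0) (\<B> n)))"
      using s_ge[of m] by (intro ln_mono) auto
    ultimately have "ln (s n) - ln (s 1) \<le> ln (real (min_subcover_card (\<Lambda> 0) (\<B> n)))" by simp
    then show ?thesis
      using that by (simp add: divide_right_mono flip: diff_divide_distrib)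
  qed
  have "(\<lambda>n. ln (s n) / real n - ln (s 1) / real n) \<longlonglongrightarrow> ln (growth_rate A) - 0"
    unfolding s_def
    by (intro tendsto_diff ln_entry_sum_tendsto_growth_rate A lim_const_over_n)
  then have "(\<lambda>n. ereal (ln (s n) / real n - ln (s 1) / real n)) \<longlonglongrightarrow> ereal (ln (growth_rate A))"
    by simp
  then have "ereal (ln (growth_rate A))
      = limsup (\<lambda>n. ereal (ln (s n) / real n - ln (s 1) / real n))"
    by (intro lim_imp_Limsup[symmetric]) auto
  also have "\<dots> \<le> limsup (\<lambda>n. ereal
      (1 / real n * ln (real (min_subcover_card (\<Lambda> 0) (\<B> n)))))"
    using lower by (intro Limsup_mono eventually_mono[OF eventually_gt_at_top[of 0]]) simp
  also have "\<dots> \<le> top_entropy f (\<Lambda> 0)"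
    unfolding top_entropy_def \<B>_def using \<A>(1) by (intro SUP_upper) simp
  finally show ?thesis .
qed

section \<open>Points following admissible itineraries\<close>

text \<open>The maps are continuous only on \<open>E\<close>, so all points of the orbit before time
  \<open>k\<close> must stay there.\<close>

lemma continuous_on_iter_from:
  assumes cont: "\<And>n. continuous_on E (f n)"
  shows "continuous_on {x. \<forall>j<k. iter_from f n j x \<in> E} (iter_from f n k)"
proof (induction k)
  case 0
  then show ?case by (simp add: id_def)
next
  case (Suc k)
  have "continuous_on {x. \<forall>j<Suc k. iter_from f n j x \<in> E} (\<lambda>x. f (n + k) (iter_from f n k x))"
    by (rule continuous_on_compose2[OF cont[of "n + k"]
          continuous_on_subset[OF Suc]]) (auto simp: less_Suc_eq)
  then show ?case by (simp add: comp_def)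
qed

section \<open>Compactness of sets cut out by orbit constraints\<close>

lemma compact_INT:
  fixes S :: "'i \<Rightarrow> 'a::t2_space set"
  assumes "I \<noteq> {}" "\<And>i. i \<in> I \<Longrightarrow> compact (S i)"
  shows "compact (\<Inter>i\<in>I. S i)"
proof -
  obtain i where i: "i \<in> I" using assms(1) by blast
  have "compact (S i \<inter> (\<Inter>i\<in>I. S i))"
    using assms(2) i by (intro compact_Int_closed closed_INT ballI compact_imp_closed)
  also have "S i \<inter> (\<Inter>i\<in>I. S i) = (\<Inter>i\<in>I. S i)" using i by blast
  finally show ?thesis .
qed

text \<open>Preimages under the iterates need not be closed in the whole space. By induction the set
  of points meeting the earlier constraints is compact; the next iterate is continuous on it, so the
  new constraint cuts out a closed subset.\<close>

lemma compact_orbit_constraint: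
  fixes f :: "nat \<Rightarrow> 'a::t2_space \<Rightarrow> 'a"
  assumes cont: "\<And>n. continuous_on E (f n)"
    and T: "\<And>k. compact (T k)" "\<And>k. T k \<subseteq> E"
  shows "compact {x. \<forall>k\<le>m. iter_from f n k x \<in> T k}"
proof (induction m)
  case 0
  then show ?case using T(1)[of 0] by simp
next
  case (Suc m)
  let ?S = "{x. \<forall>k\<le>m. iter_from f n k x \<in> T k}"
  have "continuous_on ?S (iter_from f n (Suc m))"
    by (rule continuous_on_subset[OF continuous_on_iter_from[OF cont]]) (use T(2) less_Suc_eq_le in blast)
  then have "closed (?S \<inter> iter_from f n (Suc m) -` T (Suc m))"
    using Suc T(1) by (intro continuous_closed_preimage compact_imp_closed)
  with Suc have "compact (?S \<inter> (?S \<inter> iter_from f n (Suc m) -` T (Suc m)))"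
    by (rule compact_Int_closed)
  also have "?S \<inter> (?S \<inter> iter_from f n (Suc m) -` T (Suc m))
      = {x. \<forall>k\<le>Suc m. iter_from f n k x \<in> T k}"
    by (auto simp: le_Suc_eq simp del: iter_from.simps)
  finally show ?case .
qed

lemma compact_orbit_constraint_infinite:
  fixes f :: "nat \<Rightarrow> 'a::t2_space \<Rightarrow> 'a"
  assumes "\<And>n. continuous_on E (f n)" "\<And>k. compact (T k)" "\<And>k. T k \<subseteq> E"
  shows "compact {x. \<forall>k. iter_from f n k x \<in> T k}"
proof -
  have "{x. \<forall>k. iter_from f n k x \<in> T k} = (\<Inter>m. {x. \<forall>k\<le>m. iter_from f n k x \<in> T k})"
    by auto
  then show ?thesis
    using compact_orbit_constraint[where E = E and f = f and T = T and n = n, OF assms]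
    by (auto intro: compact_INT)
qed

text \<open>The finite constraints give decreasing compact sets, so the finite intersection property
  applies.\<close>

lemma orbit_constraint_nonempty:
  fixes f :: "nat \<Rightarrow> 'a::t2_space \<Rightarrow> 'a"
  assumes "\<And>n. continuous_on E (f n)" "\<And>k. compact (T k)" "\<And>k. T k \<subseteq> E"
    and ne: "\<And>m. \<exists>x. \<forall>k\<le>m. iter_from f n k x \<in> T k"
  shows "\<exists>x. \<forall>k. iter_from f n k x \<in> T k"
proof -
  let ?S = "\<lambda>m. {x. \<forall>k\<le>m. iter_from f n k x \<in> T k}"
  note cpt = compact_orbit_constraint[OF assms(1-3)]
  have "?S 0 \<inter> (\<Inter>m\<in>UNIV. ?S m) \<noteq> {}"
  proof (rule compact_imp_fip_image)
    show "compact (?S 0)" by (rule cpt)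
    show "closed (?S m)" for m by (rule compact_imp_closed[OF cpt])
    fix I :: "nat set" assume "finite I"
    then obtain M where M: "\<And>i. i \<in> I \<Longrightarrow> i \<le> M" by (metis finite_nat_set_iff_bounded_le)
    obtain x where x: "\<And>k. k \<le> M \<Longrightarrow> iter_from f n k x \<in> T k" using ne[of M] by blast
    have le:  "k \<le> M" if "m \<in> I" "k \<le> m" for m k using M[OF that(1)] that(2) by simp
    have "x \<in> ?S 0 \<inter> (\<Inter>m\<in>I. ?S m)" using x[of 0] x le by simp
    then show "?S 0 \<inter> (\<Inter>m\<in>I. ?S m) \<noteq> {}" by blast
  qed
  then obtain x where x: "x \<in> (\<Inter>m. ?S m)" unfolding ex_in_conv[symmetric] by (elim exE IntE)
  have "iter_from f n k x \<in> T k" for k using INT_D[OF x, of k] by simp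
  then show ?thesis by (intro exI[of _ x] allI)
qed

text \<open>The constant \<open>\<eta>\<close> stands for the separation of the sets
  \<open>V i\<close>: one gap for all pairs of symbols and all times. \<open>W i n\<close> is the
  compact set written V_{i,n} in the theorem.\<close>

locale coupled_expansion =
  fixes f :: "nat \<Rightarrow> 'a::metric_space \<Rightarrow> 'a"
    and A :: "real ^ 'n ^ 'n"
    and W :: "'n \<Rightarrow> nat \<Rightarrow> 'a set"
    and \<eta> :: real
  assumes compact_W: "compact (W i n)"
    and equi_cont: "equi_continuous_in dist (\<lambda>_. \<Union>n. \<Union>i. W i n) f"
    and \<eta>_pos: "\<eta> > 0"
    and separated: "\<lbrakk>i \<noteq> j; x \<in> W i m; y \<in> W j n\<rbrakk> \<Longrightarrow> \<eta> \<le> dist x y"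
    and cylinder_nonempty: "\<alpha> \<in> shift_space A \<Longrightarrow>
      \<exists>x. \<forall>k\<le>m. iter_from f n k x \<in> W (\<alpha> k) (n + k)"
begin

abbreviation E :: "'a set" where
  "E \<equiv> \<Union>n. \<Union>i. W i n"

section \<open>Itineraries and tracked points\<close>

definition follows :: "nat \<Rightarrow> 'a \<Rightarrow> (nat \<Rightarrow> 'n) \<Rightarrow> bool" where
  "follows n x \<alpha> \<longleftrightarrow> \<alpha> \<in> shift_space A \<and> (\<forall>k. iter_from f n k x \<in> W (\<alpha> k) (n + k))"

definition tracked :: "nat \<Rightarrow> 'a set" where
  "tracked n = {x. \<exists>\<alpha>. follows n x \<alpha>}"

text \<open>The semiconjugacy at time \<open>n\<close>; on \<open>tracked n\<close> the description
  is proper by \<open>follows_unique\<close>.\<close>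

definition itinerary :: "nat \<Rightarrow> 'a \<Rightarrow> nat \<Rightarrow> 'n" where
  "itinerary n x = (THE \<alpha>. follows n x \<alpha>)"

lemma W_eq_if_close: "\<lbrakk>x \<in> W i m; y \<in> W j n; dist x y < \<eta>\<rbrakk> \<Longrightarrow> i = j"
  using separated by fastforce

lemma W_unique: "\<lbrakk>x \<in> W i m; x \<in> W j n\<rbrakk> \<Longrightarrow> i = j"
  using W_eq_if_close[of x i m x j n] \<eta>_pos by simp

lemma follows_unique: "\<lbrakk>follows n x \<alpha>; follows n x \<beta>\<rbrakk> \<Longrightarrow> \<alpha> = \<beta>"
  unfolding follows_def using W_unique by blast

lemma itinerary_eqI: "follows n x \<alpha> \<Longrightarrow> itinerary n x = \<alpha>"
  unfolding itinerary_def using follows_unique by blast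

lemma follows_itinerary: "x \<in> tracked n \<Longrightarrow> follows n x (itinerary n x)"
  unfolding tracked_def using itinerary_eqI by auto

text \<open>The orbit of \<open>f n x\<close> from time \<open>n + 1\<close> is the orbit of
  \<open>x\<close> without its first point. This yields both invariance and the conjugacy
  equation.\<close>

lemma follows_step:
  assumes "follows n x \<alpha>"
  shows "follows (Suc n) (f n x) (shift \<alpha>)"
  unfolding follows_def
proof (intro conjI allI)
  show "shift \<alpha> \<in> shift_space A"
    using assms by (simp add: follows_def shift_in_shift_space)
  show "iter_from f (Suc n) k (f n x) \<in> W (shift \<alpha> k) (Suc n + k)" for k
    using assms unfolding follows_def iter_from_Suc_left[symmetric] shift_def add_Suc_shift
    by blast
qed

lemma tracked_orbit_in_E: "x \<in> tracked n \<Longrightarrow> iter_from f n k x \<in> E"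
  unfolding tracked_def follows_def by blast

lemma continuous_on_E: "continuous_on E (f n)"
proof -
  have "\<exists>\<delta>>0. \<forall>x\<in>E. \<forall>y\<in>E. dist y x < \<delta> \<longrightarrow> dist (f n y) (f n x) < \<epsilon>" if "\<epsilon> > 0" for \<epsilon>
    using equi_cont that unfolding equi_continuous_in_def by meson
  then show ?thesis
    by (intro uniformly_continuous_imp_continuous) (simp add: uniformly_continuous_on_def)
qed

text \<open>At times other than \<open>k\<close> and \<open>k + 1\<close> the orbit is still held in
  a finite union of compact sets, so that all constraints are compact subsets of
  \<open>E\<close>.\<close>

definition transition_constraint :: "nat \<Rightarrow> nat \<Rightarrow> 'n \<times> 'n \<Rightarrow> nat \<Rightarrow> 'a set" where
  "transition_constraint n k p j =
     (if j = k then W (fst p) (n + j) else if j = Suc k then W (snd p) (n + j)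
      else \<Union>i. W i (n + j))"

text \<open>
  Only two consecutive symbols are constrained at a time, so \<open>tracked n\<close> is an intersection of
  finite unions of compact sets, although it is an infinite union over all itineraries.
\<close>

lemma tracked_eq:
  "tracked n = (\<Inter>k. \<Union>p\<in>{p. A $ fst p $ snd p = 1}.
     {x. \<forall>j. iter_from f n j x \<in> transition_constraint n k p j})" (is "_ = (\<Inter>k. \<Union>p\<in>?P. ?C k p)")
proof (intro equalityI subsetI)
  fix x assume "x \<in> tracked n"
  then obtain \<alpha> where "follows n x \<alpha>" unfolding tracked_def by blast
  then have \<alpha>: "A $ \<alpha> k $ \<alpha> (Suc k) = 1" "iter_from f n k x \<in> W (\<alpha> k) (n + k)" for k
    unfolding follows_def shift_space_def by blast+
  show "x \<in> (\<Inter>k. \<Union>p\<in>?P. ?C k p)"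
  proof (rule INT_I, rule UN_I)
    fix k
    show "(\<alpha> k, \<alpha> (Suc k)) \<in> ?P" using \<alpha>(1) by simp
    have "W (\<alpha> j) (n + j) \<subseteq> transition_constraint n k (\<alpha> k, \<alpha> (Suc k)) j" for j
      unfolding transition_constraint_def by auto
    then show "x \<in> ?C k (\<alpha> k, \<alpha> (Suc k))" using \<alpha>(2) by blast
  qed
next
  fix x assume x: "x \<in> (\<Inter>k. \<Union>p\<in>?P. ?C k p)"
  have "\<exists>p. A $ fst p $ snd p = 1 \<and> iter_from f n k x \<in> W (fst p) (n + k)
      \<and> iter_from f n (Suc k) x \<in> W (snd p) (n + Suc k)" for k
  proof -
    have "x \<in> (\<Union>p\<in>?P. ?C k p)" using x by (rule INT_D) simp
    then obtain p where p: "p \<in> ?P" "x \<in> ?C k p" by (rule UN_E)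
    have "iter_from f n j x \<in> transition_constraint n k p j" for j using p(2) by simp
    from this[of k] this[of "Suc k"] p(1) show ?thesis
      unfolding transition_constraint_def by (intro exI[of _ p]) (simp del: iter_from.simps)
  qed
  then obtain p where p: "\<And>k. A $ fst (p k) $ snd (p k) = 1"
      "\<And>k. iter_from f n k x \<in> W (fst (p k)) (n + k)"
      "\<And>k. iter_from f n (Suc k) x \<in> W (snd (p k)) (n + Suc k)"
    by metis
  \<comment> \<open>Consecutive pairs overlap at time \<open>k + 1\<close>, where the symbol is
    unique, so the local choices glue to one admissible sequence.\<close>
  have "fst (p (Suc k)) = snd (p k)" for k by (rule W_unique[OF p(2) p(3)])
  then have "follows n x (\<lambda>k. fst (p k))"
    unfolding follows_def shift_space_def using p(1,2) by simp
  then show "x \<in> tracked n" unfolding tracked_def by blast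
qed

lemma compact_tracked: "compact (tracked n)"
proof -
  have "compact {x. \<forall>j. iter_from f n j x \<in> transition_constraint n k p j}" for k p
  proof (rule compact_orbit_constraint_infinite[OF continuous_on_E])
    show "compact (transition_constraint n k p j)" for j
      unfolding transition_constraint_def by (simp add: compact_W compact_UN)
    show "transition_constraint n k p j \<subseteq> E" for j
      unfolding transition_constraint_def by (simp, blast)
  qed
  then show ?thesis
    unfolding tracked_eq by (intro compact_INT compact_UN) simp_all
qed

lemma tracked_subset: "tracked n \<subseteq> (\<Union>i. W i n)"
proof
  fix x assume "x \<in> tracked n"
  then have "iter_from f n 0 x \<in> W (itinerary n x 0) (n + 0)"
    using follows_itinerary unfolding follows_def by blast
  then show "x \<in> (\<Union>i. W i n)" by auto
qed

lemma invariant_family_tracked: "invariant_family f tracked"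
  unfolding invariant_family_def tracked_def using follows_step by blast

lemma itinerary_step: "x \<in> tracked n \<Longrightarrow> itinerary (Suc n) (f n x) = shift (itinerary n x)"
  by (intro itinerary_eqI follows_step follows_itinerary)

lemma itinerary_image: "itinerary n ` tracked n = shift_space A"
proof (intro equalityI subsetI)
  fix \<alpha> assume "\<alpha> \<in> itinerary n ` tracked n"
  then show "\<alpha> \<in> shift_space A" using follows_itinerary follows_def by blast
next
  fix \<alpha> assume \<alpha>: "\<alpha> \<in> shift_space A"
  \<comment> \<open>Surjectivity is where compactness enters: it passes from the nonempty finite
    cylinders to the whole itinerary.\<close>
  have "\<exists>x. \<forall>k. iter_from f n k x \<in> W (\<alpha> k) (n + k)"
    by (rule orbit_constraint_nonempty[OF continuous_on_E])
       (auto intro: compact_W cylinder_nonempty[OF \<alpha>])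
  then obtain x where x: "follows n x \<alpha>" using \<alpha> unfolding follows_def by blast
  then have "x \<in> tracked n" unfolding tracked_def by blast
  with x show "\<alpha> \<in> itinerary n ` tracked n" using itinerary_eqI by blast
qed

text \<open>Tracked orbits never leave \<open>E\<close>, where all maps share one modulus of
  continuity, so moduli compose uniformly in the starting time \<open>n\<close> for each fixed
  \<open>k\<close>.\<close>

lemma equi_continuous_iter_from:
  "equi_continuous_in dist tracked (\<lambda>n. iter_from f n k)"
  unfolding equi_continuous_in_def
proof (induction k)
  case 0
  then show ?case by auto
next
  case (Suc k)
  show ?case
  proof (intro allI impI)
    fix \<epsilon> :: real assume "\<epsilon> > 0"
    then obtain \<delta> where "\<delta> > 0"
        and \<delta>: "\<And>n x y. \<lbrakk>x \<in> E; y \<in> E; dist x y < \<delta>\<rbrakk> \<Longrightarrow> dist (f n x) (f n y) < \<epsilon>"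
      using equi_cont unfolding equi_continuous_in_def by metis
    obtain \<delta>' where "\<delta>' > 0" and \<delta>': "\<And>n x y. \<lbrakk>x \<in> tracked n; y \<in> tracked n; dist x y < \<delta>'\<rbrakk>
        \<Longrightarrow> dist (iter_from f n k x) (iter_from f n k y) < \<delta>"
      using Suc \<open>\<delta> > 0\<close> by metis
    have "dist (iter_from f n (Suc k) x) (iter_from f n (Suc k) y) < \<epsilon>"
      if "x \<in> tracked n" "y \<in> tracked n" "dist x y < \<delta>'" for n x y
      unfolding iter_from.simps comp_apply
      using that by (intro \<delta> \<delta>' tracked_orbit_in_E)
    with \<open>\<delta>' > 0\<close> show "\<exists>\<delta>>0. \<forall>n. \<forall>x\<in>tracked n. \<forall>y\<in>tracked n. dist x y < \<delta> \<longrightarrow>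
        dist (iter_from f n (Suc k) x) (iter_from f n (Suc k) y) < \<epsilon>" by blast
  qed
qed

lemma itinerary_nth_eq_if_close:
  assumes "x \<in> tracked n" "y \<in> tracked n" "dist (iter_from f n k x) (iter_from f n k y) < \<eta>"
  shows "itinerary n x k = itinerary n y k"
  using assms follows_itinerary W_eq_if_close unfolding follows_def by blast

lemma equi_continuous_itinerary: "equi_continuous_in seq_dist tracked itinerary"
  unfolding equi_continuous_in_def
proof (intro allI impI)
  fix \<epsilon> :: real assume "\<epsilon> > 0"
  then obtain m where m: "(1 / 2) ^ m < \<epsilon>" using real_arch_pow_inv[of \<epsilon> "1 / 2"] by auto
  have "\<forall>k. \<exists>\<delta>>0. \<forall>n. \<forall>x\<in>tracked n. \<forall>y\<in>tracked n. dist x y < \<delta> \<longrightarrow>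
      dist (iter_from f n k x) (iter_from f n k y) < \<eta>"
    using equi_continuous_iter_from \<eta>_pos unfolding equi_continuous_in_def by blast
  then obtain \<delta> where \<delta>: "\<And>k. \<delta> k > 0" "\<And>k n x y. \<lbrakk>x \<in> tracked n; y \<in> tracked n; dist x y < \<delta> k\<rbrakk>
      \<Longrightarrow> dist (iter_from f n k x) (iter_from f n k y) < \<eta>"
    by metis
  have "seq_dist (itinerary n x) (itinerary n y) < \<epsilon>"
    \<comment> \<open>The minimum of \<open>m + 1\<close> moduli keeps the orbits \<eta>-close up to
      time \<open>m\<close>, which forces the first \<open>m + 1\<close> symbols to agree.\<close>
    if "x \<in> tracked n" "y \<in> tracked n" "dist x y < Min (\<delta> ` {..m})" for n x y
  proof -
    have "itinerary n x k = itinerary n y k" if "k \<le> m" for k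
      using that \<open>x \<in> _\<close> \<open>y \<in> _\<close> \<open>dist x y < _\<close>
      by (intro itinerary_nth_eq_if_close \<delta>(2)) auto
    then have "seq_dist (itinerary n x) (itinerary n y) \<le> (1 / 2) ^ m"
      by (rule seq_dist_le_if_agree)
    with m show ?thesis by simp
  qed
  moreover have "Min (\<delta> ` {..m}) > 0" using \<delta>(1) by (simp add: Min_gr_iff)
  ultimately show "\<exists>\<delta>>0. \<forall>n. \<forall>x\<in>tracked n. \<forall>y\<in>tracked n. dist x y < \<delta> \<longrightarrow>
      seq_dist (itinerary n x) (itinerary n y) < \<epsilon>" by blast
qed

lemma equi_semiconjugate_tracked: "equi_semiconjugate_to_shift f tracked A"
  unfolding equi_semiconjugate_to_shift_def
  using itinerary_image equi_continuous_itinerary itinerary_step by blast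

end

lemma finite_separation:
  fixes V :: "'n::finite \<Rightarrow> 'a::metric_space set"
  assumes "\<And>i j. i \<noteq> j \<Longrightarrow> setdist (V i) (V j) > 0"
  shows "\<exists>\<eta>>0. \<forall>i j. i \<noteq> j \<longrightarrow> (\<forall>x\<in>V i. \<forall>y\<in>V j. \<eta> \<le> dist x y)"
proof (intro exI conjI allI impI ballI)
  \<comment> \<open>The element 1 keeps \<open>Min\<close> meaningful if there are no two distinct
    symbols.\<close>
  let ?D = "insert 1 ((\<lambda>(i, j). setdist (V i) (V j)) ` {(i, j). i \<noteq> j})"
  have fin: "finite ?D" by simp
  show "Min ?D > 0" using fin assms by (subst Min_gr_iff) auto
  fix i j x y assume ij: "i \<noteq> j" and xy: "x \<in> V i" "y \<in> V j"
  have "Min ?D \<le> setdist (V i) (V j)" using fin ij by (intro Min_le) auto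
  also have "\<dots> \<le> dist x y" using xy by (intro setdist_le_dist)
  finally show "Min ?D \<le> dist x y" .
qed

theorem theorem3p3:
  fixes f :: "nat \<Rightarrow> 'a::metric_space \<Rightarrow> 'a"
    and A :: "real ^ 'n ^ 'n"
    and V :: "'n \<Rightarrow> 'a set"
    and W :: "'n \<Rightarrow> nat \<Rightarrow> 'a set"
  assumes "transition_matrix A"
    and "\<And>i. V i \<noteq> {}"
    and "\<And>i j. i \<noteq> j \<Longrightarrow> setdist (V i) (V j) > 0"
    and "\<And>i n. W i n \<noteq> {}"
    and "\<And>i n. compact (W i n)"
    and "\<And>i n. W i n \<subseteq> V i"
    and "equi_continuous_in dist (\<lambda>_. \<Union>n. \<Union>i. W i n) f"
    and "\<And>m n \<alpha>. \<alpha> \<in> shift_space A \<Longrightarrow>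
           (\<Inter>k\<in>{0..m}. iter_from f n k -` W (\<alpha> k) (n + k)) \<noteq> {}"
  shows "\<exists>\<Lambda> :: nat \<Rightarrow> 'a set.
           (\<forall>n. \<Lambda> n \<noteq> {} \<and> compact (\<Lambda> n) \<and> \<Lambda> n \<subseteq> (\<Union>i. W i n)) \<and>
           invariant_family f \<Lambda> \<and>
           equi_semiconjugate_to_shift f \<Lambda> A \<and>
           (compact (UNIV :: 'a set) \<longrightarrow> top_entropy f (\<Lambda> 0) \<ge> ereal (ln (growth_rate A)))"
proof -
  obtain \<eta> where \<eta>: "\<eta> > 0" "\<forall>i j. i \<noteq> j \<longrightarrow> (\<forall>x\<in>V i. \<forall>y\<in>V j. \<eta> \<le> dist x y)"
    using finite_separation[of V] assms(3) by auto
  interpret coupled_expansion f A W \<eta>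
  proof
    show "\<exists>x. \<forall>k\<le>m. iter_from f n k x \<in> W (\<alpha> k) (n + k)" if \<alpha>: "\<alpha> \<in> shift_space A" for \<alpha> m n
    proof -
      obtain x where "x \<in> (\<Inter>k\<in>{0..m}. iter_from f n k -` W (\<alpha> k) (n + k))"
        using assms(8)[OF \<alpha>] by (metis ex_in_conv)
      then show ?thesis by (intro exI[of _ x]) simp
    qed
    show "\<eta> \<le> dist x y" if "i \<noteq> j" "x \<in> W i m" "y \<in> W j n" for i j x y m n
      using \<eta>(2) that subsetD[OF assms(6)] by simp
  qed (use assms(5,7) \<eta>(1) in auto)
  have "shift_space A \<noteq> {}" using shift_space_starting_at[OF assms(1)] by blast
  then have "tracked n \<noteq> {}" for n using itinerary_image by blast
  then show ?thesis
    by (intro exI[of _ tracked] conjI allI impI compact_tracked tracked_subset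
        invariant_family_tracked equi_semiconjugate_tracked
        top_entropy_ge_growth_rate[OF _ assms(1)])
qed

end
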